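(* For any positive integer $m$ with $m\equiv 2\pmod 4$, the diagonal binary $\mathbb Z$-lattice $\ell=\langle 1,m\rangle$ is not recoverable.
   Context: A $\mathbb Z$-lattice is a free $\mathbb Z$-module $L$ of finite rank with a positive definite symmetric bilinear form $B:L\times L\to\mathbb Z$ (integral valued). $\langle a_1,\dots,a_k\rangle$ denotes the $\mathbb Z$-lattice with an orthogonal basis $x_1,\dots,x_k$ satisfying $B(x_i,x_i)=a_i$. A $\mathbb Z$-lattice $\ell$ is represented by $L$ if there is a $\mathbb Z$-linear map $\sigma:\ell\to L$ with $B(\sigma x,\sigma y)=B(x,y)$ for all $x,y\in\ell$. A $\mathbb Z$-lattice $\ell$ is recoverable if there is a finite set $\{\ell_1,\dots,\ell_t\}$ of proper sublattices of $\ell$ such that every $\mathbb Z$-lattice (of any rank) that represents all of $\ell_1,\dots,\ell_t$ also represents $\ell$. *)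

theory Defs
  imports "HOL-Algebra.Free_Abelian_Groups" "HOL-Number_Theory.Cong"
begin

text \<open>A \<open>\<int>\<close>-module is the same thing as an abelian group and a \<open>\<int>\<close>-linear map the same thing as
  a group homomorphism. Groups are multiplicative in HOL-Algebra, so \<open>x \<otimes>\<^bsub>L\<^esub> y\<close> is the sum
  of \<open>x\<close> and \<open>y\<close>, and \<open>\<one>\<^bsub>L\<^esub>\<close> is the zero vector.\<close>

record 'a zlattice = "'a monoid" +
  form :: "'a \<Rightarrow> 'a \<Rightarrow> int"

locale zlattice = comm_group L for L :: "('a, 'c) zlattice_scheme" (structure) +
  assumes free_finite_rank: "\<exists>n::nat. L \<cong> free_Abelian_group {..<n}"
    and form_add_left:
      "\<lbrakk>x \<in> carrier L; y \<in> carrier L; z \<in> carrier L\<rbrakk>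
        \<Longrightarrow> form L (x \<otimes> y) z = form L x z + form L y z"
    and form_sym: "\<lbrakk>x \<in> carrier L; y \<in> carrier L\<rbrakk> \<Longrightarrow> form L x y = form L y x"
    and form_pos: "\<lbrakk>x \<in> carrier L; x \<noteq> \<one>\<rbrakk> \<Longrightarrow> form L x x > 0"

definition represents ::
    "('b, 'd) zlattice_scheme \<Rightarrow> ('a, 'c) zlattice_scheme \<Rightarrow> bool" where
  "represents L l \<longleftrightarrow>
     (\<exists>\<sigma>\<in>hom l L. \<forall>x\<in>carrier l. \<forall>y\<in>carrier l. form L (\<sigma> x) (\<sigma> y) = form l x y)"

text \<open>A sublattice of \<open>l\<close> is a subgroup \<open>H\<close> of \<open>l\<close>, of any rank, with the restricted form: it is the
  lattice \<open>l\<lparr>carrier := H\<rparr>\<close>, and it is automatically free of finite rank.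

  HOL cannot quantify over the type of the elements of a lattice inside a definition. Here \<open>L\<close>
  ranges over the lattices whose elements have type \<open>nat \<Rightarrow>\<^sub>0 int\<close>; by \<open>zlattice_copy\<close> every
  lattice is isometric to one of these, and \<open>recoverable_any_type\<close> removes the restriction.\<close>

definition recoverable :: "('a, 'c) zlattice_scheme \<Rightarrow> bool" where
  "recoverable l \<longleftrightarrow>
     (\<exists>\<H>. finite \<H> \<and> (\<forall>H\<in>\<H>. subgroup H l \<and> H \<noteq> carrier l) \<and>
        (\<forall>L :: (nat \<Rightarrow>\<^sub>0 int) zlattice.
           zlattice L \<longrightarrow> (\<forall>H\<in>\<H>. represents L (l\<lparr>carrier := H\<rparr>)) \<longrightarrow> represents L l))"

text \<open>The orthogonal basis of \<open>\<langle>a\<^sub>1, \<dots>, a\<^sub>k\<rangle>\<close> consists of the unit vectors \<open>frag_of i\<close> for \<open>i < k\<close>,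
  so the indices are shifted by one; see \<open>form_diag_lattice_frag_of\<close>.\<close>

definition diag_lattice :: "int list \<Rightarrow> (nat \<Rightarrow>\<^sub>0 int) zlattice" where
  "diag_lattice as =
     monoid.extend (free_Abelian_group {..<length as})
       (zlattice.fields (\<lambda>x y.
         \<Sum>i<length as. as ! i * Poly_Mapping.lookup x i * Poly_Mapping.lookup y i))"

lemma diag_lattice_simps [simp]:
  "carrier (diag_lattice as) = {c. Poly_Mapping.keys c \<subseteq> {..<length as}}"
  "x \<otimes>\<^bsub>diag_lattice as\<^esub> y = x + y"
  "\<one>\<^bsub>diag_lattice as\<^esub> = 0"
  "form (diag_lattice as) x y =
     (\<Sum>i<length as. as ! i * Poly_Mapping.lookup x i * Poly_Mapping.lookup y i)"
  by (simp_all add: diag_lattice_def monoid.defs zlattice.defs free_Abelian_group_def)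

lemma form_diag_lattice_frag_of:
  assumes "i < length as" "j < length as"
  shows "form (diag_lattice as) (frag_of i) (frag_of j) = (if i = j then as ! i else 0)"
proof -
  have "form (diag_lattice as) (frag_of i) (frag_of j) =
      (\<Sum>k<length as. if k = i then (if i = j then as ! i else 0) else 0)"
    unfolding diag_lattice_simps by (rule sum.cong) (auto simp: lookup_single when_def)
  then show ?thesis
    using assms by simp
qed

lemma zlattice_diag_lattice:
  assumes pos: "\<And>a. a \<in> set as \<Longrightarrow> a > 0"
  shows "zlattice (diag_lattice as)"
proof -
  let ?F = "free_Abelian_group {..<length as}"
  have id_iso: "id \<in> iso (diag_lattice as) ?F"
    by (auto simp: iso_def hom_def bij_betw_def)
  have cg: "comm_group (diag_lattice as)"
  proof (intro comm_groupI)
    fix x assume "x \<in> carrier (diag_lattice as)"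
    then show "\<exists>y\<in>carrier (diag_lattice as). y \<otimes>\<^bsub>diag_lattice as\<^esub> x = \<one>\<^bsub>diag_lattice as\<^esub>"
      by (intro bexI[of _ "-x"]) auto
  qed (auto simp: add_ac dest!: subsetD[OF keys_add])
  show ?thesis
  proof (intro zlattice.intro[OF cg] zlattice_axioms.intro)
    show "\<exists>n::nat. diag_lattice as \<cong> free_Abelian_group {..<n}"
      using id_iso is_isoI by blast
  next
    fix x assume x: "x \<in> carrier (diag_lattice as)" "x \<noteq> \<one>\<^bsub>diag_lattice as\<^esub>"
    then obtain i where i: "Poly_Mapping.lookup x i \<noteq> 0"
      by (metis diag_lattice_simps(3) lookup_zero poly_mapping_eqI)
    with x have il: "i < length as"
      by (auto simp: in_keys_iff subset_iff)
    have "0 < (\<Sum>i<length as. as ! i * (Poly_Mapping.lookup x i * Poly_Mapping.lookup x i))"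
    proof (rule sum_pos2[of _ i])
      show "0 < as ! i * (Poly_Mapping.lookup x i * Poly_Mapping.lookup x i)"
        using i il pos[of "as ! i"] by (simp add: zero_less_mult_iff) linarith
      show "0 \<le> as ! j * (Poly_Mapping.lookup x j * Poly_Mapping.lookup x j)" if "j \<in> {..<length as}" for j
        using that pos[of "as ! j"] by simp
    qed (use il in auto)
    then show "0 < form (diag_lattice as) x x"
      by (simp add: mult.assoc)
  qed (simp_all add: lookup_add algebra_simps sum.distrib)
qed

lemma represents_trans:
  assumes "represents M L" "represents L l"
  shows "represents M l"
proof -
  obtain \<tau> where \<tau>: "\<tau> \<in> hom L M"
      "\<forall>x\<in>carrier L. \<forall>y\<in>carrier L. form M (\<tau> x) (\<tau> y) = form L x y"
    using assms(1) by (auto simp: represents_def)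
  obtain \<sigma> where \<sigma>: "\<sigma> \<in> hom l L"
      "\<forall>x\<in>carrier l. \<forall>y\<in>carrier l. form L (\<sigma> x) (\<sigma> y) = form l x y"
    using assms(2) by (auto simp: represents_def)
  show ?thesis
    unfolding represents_def
  proof (intro bexI[of _ "\<tau> \<circ> \<sigma>"] ballI)
    show "\<tau> \<circ> \<sigma> \<in> hom l M"
      using \<tau>(1) \<sigma>(1) by (auto simp: hom_def)
    show "form M ((\<tau> \<circ> \<sigma>) x) ((\<tau> \<circ> \<sigma>) y) = form l x y"
      if "x \<in> carrier l" "y \<in> carrier l" for x y
      using that \<tau>(2) \<sigma> by (auto simp: hom_def Pi_iff)
  qed
qed

lemma zlattice_copy:
  assumes "zlattice L"
  obtains M :: "(nat \<Rightarrow>\<^sub>0 int) zlattice" and f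
  where "zlattice M" "f \<in> iso L M"
    "\<And>x y. \<lbrakk>x \<in> carrier L; y \<in> carrier L\<rbrakk> \<Longrightarrow> form M (f x) (f y) = form L x y"
proof -
  interpret L: zlattice L by fact
  obtain n f where f: "f \<in> iso L (free_Abelian_group {..<n::nat})"
    using L.free_finite_rank by (auto simp: is_iso_def)
  define F where "F = free_Abelian_group {..<n}"
  define g where "g = inv_into (carrier L) f"
  define M where "M = monoid.extend F (zlattice.fields (\<lambda>x y. form L (g x) (g y)))"
  have M [simp]: "carrier M = carrier F" "monoid.mult M = monoid.mult F" "one M = one F"
      "form M = (\<lambda>x y. form L (g x) (g y))"
    by (simp_all add: M_def monoid.defs zlattice.defs)
  interpret F: comm_group F
    unfolding F_def by (rule abelian_free_Abelian_group)
  have f': "f \<in> iso L F"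
    using f by (simp add: F_def)
  have g: "g \<in> iso F L"
    using L.iso_set_sym[OF f'] by (simp add: g_def)
  have gf: "g (f x) = x" if "x \<in> carrier L" for x
    using f' that by (auto simp: g_def iso_def bij_betw_def)
  have gc: "g x \<in> carrier L" if "x \<in> carrier F" for x
    using g that by (auto simp: iso_def hom_def)
  have gm: "g (x \<otimes>\<^bsub>F\<^esub> y) = g x \<otimes>\<^bsub>L\<^esub> g y" if "x \<in> carrier F" "y \<in> carrier F" for x y
    using g that by (auto simp: iso_def hom_def)
  have g1: "g x = \<one>\<^bsub>L\<^esub> \<longleftrightarrow> x = \<one>\<^bsub>F\<^esub>" if "x \<in> carrier F" for x
  proof -
    have "g \<one>\<^bsub>F\<^esub> = \<one>\<^bsub>L\<^esub>" "inj_on g (carrier F)"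
      using g hom_one[of g F L] F.is_group L.is_group by (simp_all add: iso_def bij_betw_def)
    then show ?thesis
      using that by (metis F.one_closed inj_onD)
  qed
  have cg: "comm_group M"
    by (intro comm_groupI) (auto simp: F.m_ac intro: F.l_inv_ex)
  have "zlattice M"
  proof (intro zlattice.intro[OF cg] zlattice_axioms.intro)
    have "id \<in> iso M F"
      by (auto simp: iso_def hom_def)
    then show "\<exists>n::nat. M \<cong> free_Abelian_group {..<n}"
      unfolding F_def using is_isoI by blast
  qed (auto simp: gc gm g1 L.form_add_left L.form_pos intro: L.form_sym)
  moreover have "f \<in> iso L M"
    using f' by (auto simp: iso_def hom_def)
  ultimately show ?thesis
    by (rule that) (simp add: gf)
qed

lemma recoverable_any_type:
  assumes "\<And>M :: (nat \<Rightarrow>\<^sub>0 int) zlattice.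
      \<lbrakk>zlattice M; \<forall>H\<in>\<H>. represents M (l\<lparr>carrier := H\<rparr>)\<rbrakk> \<Longrightarrow> represents M l"
    and "zlattice L" "\<forall>H\<in>\<H>. represents L (l\<lparr>carrier := H\<rparr>)"
  shows "represents L l"
proof -
  interpret L: zlattice L by fact
  obtain M :: "(nat \<Rightarrow>\<^sub>0 int) zlattice" and f where M: "zlattice M" and f: "f \<in> iso L M"
    and fB: "\<And>x y. \<lbrakk>x \<in> carrier L; y \<in> carrier L\<rbrakk> \<Longrightarrow> form M (f x) (f y) = form L x y"
    using zlattice_copy[OF assms(2)] by blast
  have 1: "represents M L"
    using f fB by (auto simp: represents_def iso_def)
  define g where "g = inv_into (carrier L) f"
  have g: "g \<in> iso M L"
    using L.iso_set_sym[OF f] by (simp add: g_def)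
  have gc: "g x \<in> carrier L" "f (g x) = x" if "x \<in> carrier M" for x
    using f that by (auto simp: g_def iso_def bij_betw_def inv_into_into f_inv_into_f)
  have "form L (g x) (g y) = form M x y" if "x \<in> carrier M" "y \<in> carrier M" for x y
    using fB[of "g x" "g y"] gc that by simp
  then have 2: "represents L M"
    using g by (auto simp: represents_def iso_def)
  have "represents M l"
    using assms(1)[OF M] assms(3) represents_trans[OF 1] by blast
  then show ?thesis
    by (rule represents_trans[OF 2])
qed

end

theory Submission
  imports Defs
begin

text \<open>A proper sublattice of \<open>\<langle>1, m\<rangle>\<close>, with coordinates \<open>(u, v)\<close>, is contained in one given by
  \<open>n dvd v\<close> or by \<open>n dvd u - r v\<close>, where \<open>n \<ge> 2\<close> and \<open>0 \<le> r < n\<close>. Choose an integral linear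
  form \<open>f\<close> on it such that \<open>u\<^sup>2 + m v\<^sup>2 - f\<^sup>2\<close> is positive definite; then the sublattice is represented
  by \<open>\<langle>1\<rangle>\<close> plus an orthogonal binary block. In the critical case, \<open>n dvd u - r v\<close> with \<open>n \<le> m\<close>, put
  \<open>f = (n - 2) s + (r - 1) v\<close> where \<open>u = n s + r v\<close>: vectors with \<open>v = 0\<close> get the norm
  \<open>(n\<^sup>2 - (n - 2)\<^sup>2) s\<^sup>2\<close>, a multiple of 4, and all others have norm greater than \<open>m\<close>, except that \<open>m - 1\<close>
  occurs if \<open>r = 0\<close>. For \<open>m \<ge> 6\<close> with \<open>m mod 4 = 2\<close> no sum of such norms is 1 or \<open>m\<close>, so
  \<open>\<langle>1\<rangle>\<close> plus all the blocks does not represent \<open>\<langle>1, m\<rangle>\<close>. For \<open>m = 2\<close> the blocks avoid the norms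
  1 and 2, and a single further summand \<open>\<langle>m - 1\<rangle> = \<langle>1\<rangle>\<close> serves all sublattices with \<open>r = 0\<close>.\<close>

section \<open>Lattices built from a diagonal part and binary blocks\<close>

text \<open>The triple \<open>(a, b, c)\<close> stands for the Gram matrix with rows
  \<open>a, b\<close> and \<open>b, c\<close>. The cross term of a norm is therefore
  \<open>2 * b * s * t\<close>, and the bilinear form is integral for all integers \<open>a\<close>,
  \<open>b\<close>, \<open>c\<close>.\<close>

definition binary_form :: "int \<times> int \<times> int \<Rightarrow> int \<times> int \<Rightarrow> int \<times> int \<Rightarrow> int" where
  "binary_form = (\<lambda>(a, b, c) (s, t) (s', t'). a * s * s' + b * (s * t' + t * s') + c * t * t')"

lemma binary_form_apply [simp]:
  "binary_form (a, b, c) (s, t) (s', t') = a * s * s' + b * (s * t' + t * s') + c * t * t'"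
  by (simp add: binary_form_def)

lemma binary_form_sym: "binary_form q x y = binary_form q y x"
  by (cases q; cases x; cases y) (simp add: algebra_simps)

lemma binary_form_add_left:
  "binary_form q (s + s', t + t') y = binary_form q (s, t) y + binary_form q (s', t') y"
  by (cases q; cases y) (simp add: algebra_simps)

lemma binary_form_zero [simp]: "binary_form q (0, 0) y = 0" "binary_form q y (0, 0) = 0"
  by (cases q; cases y; simp)+

definition binary_pos_def :: "int \<times> int \<times> int \<Rightarrow> bool" where
  "binary_pos_def q \<longleftrightarrow> (\<forall>x. x \<noteq> (0, 0) \<longrightarrow> binary_form q x x > 0)"

lemma binary_form_nonneg: "binary_pos_def q \<Longrightarrow> binary_form q x x \<ge> 0"
  by (cases "x = (0, 0)") (auto simp only: binary_pos_def_def binary_form_zero intro: less_imp_le)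

text \<open>The indices 0 and 1 are reserved for the diagonal part, so block 0 starts at index
  2.\<close>

definition block :: "nat \<Rightarrow> (nat \<Rightarrow>\<^sub>0 int) \<Rightarrow> int \<times> int" where
  "block j x = (Poly_Mapping.lookup x (2 * j + 2), Poly_Mapping.lookup x (2 * j + 3))"

definition block_form :: "(int \<times> int \<times> int) list \<Rightarrow> (nat \<Rightarrow>\<^sub>0 int) \<Rightarrow> (nat \<Rightarrow>\<^sub>0 int) \<Rightarrow> int" where
  "block_form qs x y = (\<Sum>j<length qs. binary_form (qs ! j) (block j x) (block j y))"

text \<open>This is \<open><1> + <c>\<close> plus one orthogonal binary summand for each entry of
  \<open>qs\<close>. It is applied with \<open>c = m - 1\<close>, which for \<open>m = 2\<close>
  gives a second summand \<open><1>\<close>.\<close>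

definition block_lattice :: "int \<Rightarrow> (int \<times> int \<times> int) list \<Rightarrow> (nat \<Rightarrow>\<^sub>0 int) zlattice" where
  "block_lattice c qs =
     monoid.extend (free_Abelian_group {..<2 * length qs + 2})
       (zlattice.fields (\<lambda>x y.
         Poly_Mapping.lookup x 0 * Poly_Mapping.lookup y 0 +
         c * Poly_Mapping.lookup x 1 * Poly_Mapping.lookup y 1 + block_form qs x y))"

lemma block_lattice_simps [simp]:
  "carrier (block_lattice c qs) = {x. Poly_Mapping.keys x \<subseteq> {..<2 * length qs + 2}}"
  "x \<otimes>\<^bsub>block_lattice c qs\<^esub> y = x + y"
  "\<one>\<^bsub>block_lattice c qs\<^esub> = 0"
  "form (block_lattice c qs) x y =
     Poly_Mapping.lookup x 0 * Poly_Mapping.lookup y 0 +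
     c * Poly_Mapping.lookup x 1 * Poly_Mapping.lookup y 1 + block_form qs x y"
  by (simp_all add: block_lattice_def monoid.defs zlattice.defs free_Abelian_group_def)

lemma block_form_nonneg:
  assumes "\<forall>q\<in>set qs. binary_pos_def q"
  shows "block_form qs x x \<ge> 0"
  unfolding block_form_def
  using assms by (auto intro!: sum_nonneg binary_form_nonneg)

lemma block_form_eq_0D:
  assumes "\<forall>q\<in>set qs. binary_pos_def q" "block_form qs x x = 0" "j < length qs"
  shows "block j x = (0, 0)"
proof -
  have nonneg: "binary_form (qs ! i) (block i x) (block i x) \<ge> 0" if "i < length qs" for i
    using assms(1) that by (simp add: binary_form_nonneg)
  have "binary_form (qs ! j) (block j x) (block j x) = 0"
    using assms(2,3) nonneg unfolding block_form_def
    by (subst (asm) sum_nonneg_eq_0_iff) auto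
  then show ?thesis
    using assms(1,3) by (metis binary_pos_def_def less_irrefl nth_mem)
qed

lemma block_index_cases:
  fixes i k :: nat
  assumes "i < 2 * k + 2"
  obtains "i = 0" | "i = 1" | j where "j < k" "i = 2 * j + 2 \<or> i = 2 * j + 3"
proof -
  have "i = 0 \<or> i = 1 \<or> (i - 2) div 2 < k \<and>
      (i = 2 * ((i - 2) div 2) + 2 \<or> i = 2 * ((i - 2) div 2) + 3)"
    using assms by presburger
  then show ?thesis
    using that by blast
qed

lemma zlattice_block_lattice:
  assumes c: "c > 0" and pos: "\<forall>q\<in>set qs. binary_pos_def q"
  shows "zlattice (block_lattice c qs)"
proof -
  let ?L = "block_lattice c qs"
  have id_iso: "id \<in> iso ?L (free_Abelian_group {..<2 * length qs + 2})"
    by (auto simp: iso_def hom_def bij_betw_def)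
  have cg: "comm_group ?L"
  proof (intro comm_groupI)
    fix x assume "x \<in> carrier ?L"
    then show "\<exists>y\<in>carrier ?L. y \<otimes>\<^bsub>?L\<^esub> x = \<one>\<^bsub>?L\<^esub>"
      by (intro bexI[of _ "-x"]) auto
  qed (auto simp: add_ac dest!: subsetD[OF keys_add])
  show ?thesis
  proof (intro zlattice.intro[OF cg] zlattice_axioms.intro)
    show "\<exists>n::nat. ?L \<cong> free_Abelian_group {..<n}"
      using id_iso is_isoI by blast
  next
    fix x assume x: "x \<in> carrier ?L" "x \<noteq> \<one>\<^bsub>?L\<^esub>"
    then obtain i where i: "Poly_Mapping.lookup x i \<noteq> 0"
      by (metis block_lattice_simps(3) lookup_zero poly_mapping_eqI)
    with x have il: "i < 2 * length qs + 2"
      by (auto simp: in_keys_iff subset_iff)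
    let ?a = "Poly_Mapping.lookup x 0 * Poly_Mapping.lookup x 0"
    let ?b = "c * (Poly_Mapping.lookup x 1 * Poly_Mapping.lookup x 1)"
    have nonneg: "?a \<ge> 0" "?b \<ge> 0" "block_form qs x x \<ge> 0"
      using c block_form_nonneg[OF pos] by simp_all
    have "?a \<noteq> 0 \<or> ?b \<noteq> 0 \<or> block_form qs x x \<noteq> 0"
      using il
    proof (cases rule: block_index_cases)
      case (3 j)
      then have "block j x \<noteq> (0, 0)"
        using i by (auto simp: block_def)
      then show ?thesis
        using block_form_eq_0D[OF pos _ 3(1)] by blast
    qed (use i c in auto)
    then have "?a + ?b + block_form qs x x > 0"
      using nonneg by linarith
    then show "0 < form ?L x x"
      by (simp add: mult.assoc)
  next
    fix x y z
    have "block_form qs (x + y) z = block_form qs x z + block_form qs y z"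
      by (simp add: block_form_def block_def lookup_add binary_form_add_left sum.distrib)
    then show "form ?L (x \<otimes>\<^bsub>?L\<^esub> y) z = form ?L x z + form ?L y z"
      by (simp add: lookup_add algebra_simps)
  next
    fix x y
    have "block_form qs x y = block_form qs y x"
      by (simp add: block_form_def binary_form_sym)
    then show "form ?L x y = form ?L y x"
      by simp
  qed
qed

text \<open>If \<open>q\<close> is the form with index \<open>j\<close>, the map fills the
  coordinates 0 and 1 and block \<open>j\<close> and is zero in all other blocks. The remaining
  entries of \<open>qs\<close> may thus be arbitrary, which allows one lattice to serve many
  sublattices at once.\<close>

lemma represents_block_lattice:
  assumes homs: "f \<in> hom l integer_group" "g \<in> hom l integer_group"
      "s \<in> hom l integer_group" "t \<in> hom l integer_group"
    and q: "q \<in> set qs"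
    and form_eq: "\<And>x y. \<lbrakk>x \<in> carrier l; y \<in> carrier l\<rbrakk> \<Longrightarrow>
      form l x y = f x * f y + c * g x * g y + binary_form q (s x, t x) (s y, t y)"
  shows "represents (block_lattice c qs) l"
proof -
  obtain j where j: "j < length qs" "qs ! j = q"
    using q by (auto simp: in_set_conv_nth)
  define \<sigma> where "\<sigma> x = Poly_Mapping.single 0 (f x) + Poly_Mapping.single 1 (g x) +
      Poly_Mapping.single (2 * j + 2) (s x) + Poly_Mapping.single (2 * j + 3) (t x)" for x
  have look: "Poly_Mapping.lookup (\<sigma> x) i =
      (if i = 0 then f x else if i = 1 then g x else if i = 2 * j + 2 then s x
       else if i = 2 * j + 3 then t x else 0)" for x i
    by (auto simp: \<sigma>_def lookup_add lookup_single when_def)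
  have block: "block i (\<sigma> x) = (if i = j then (s x, t x) else (0, 0))" for x i
    unfolding block_def look by simp
  have "block_form qs (\<sigma> x) (\<sigma> y) = binary_form q (s x, t x) (s y, t y)" for x y
  proof -
    have "block_form qs (\<sigma> x) (\<sigma> y) =
        (\<Sum>i<length qs. if i = j then binary_form q (s x, t x) (s y, t y) else 0)"
      unfolding block_form_def by (rule sum.cong) (auto simp: block j)
    then show ?thesis
      using j by simp
  qed
  then have "form (block_lattice c qs) (\<sigma> x) (\<sigma> y) = form l x y"
    if "x \<in> carrier l" "y \<in> carrier l" for x y
    using form_eq[OF that] by (simp add: look)
  moreover have "\<sigma> \<in> hom l (block_lattice c qs)"
  proof (rule homI)
    fix x y assume xy: "x \<in> carrier l" "y \<in> carrier l"
    have "f (x \<otimes>\<^bsub>l\<^esub> y) = f x + f y" "g (x \<otimes>\<^bsub>l\<^esub> y) = g x + g y"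
      "s (x \<otimes>\<^bsub>l\<^esub> y) = s x + s y" "t (x \<otimes>\<^bsub>l\<^esub> y) = t x + t y"
      using homs xy by (simp_all add: hom_def)
    then show "\<sigma> (x \<otimes>\<^bsub>l\<^esub> y) = \<sigma> x \<otimes>\<^bsub>block_lattice c qs\<^esub> \<sigma> y"
      by (simp add: \<sigma>_def single_add add_ac)
  next
    fix x
    have "i < 2 * length qs + 2" if "Poly_Mapping.lookup (\<sigma> x) i \<noteq> 0" for i
      using that j(1) by (auto simp: look split: if_splits)
    then show "\<sigma> x \<in> carrier (block_lattice c qs)"
      by (auto simp: in_keys_iff)
  qed
  ultimately show ?thesis
    by (auto simp: represents_def)
qed

section \<open>Norms that the blocks may take, and why they miss \<open><1, m>\<close>\<close>

text \<open>For \<open>m = 2\<close> the value \<open>m - 1 = 1\<close> must be excluded: two blocks with this value would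
  represent 2.\<close>

definition harmless :: "int \<Rightarrow> int \<Rightarrow> bool" where
  "harmless m v \<longleftrightarrow> v \<ge> 0 \<and> (v > m \<or> v = m - 1 \<and> m \<noteq> 2 \<or> 4 dvd v)"

definition harmless_form :: "int \<Rightarrow> int \<times> int \<times> int \<Rightarrow> bool" where
  "harmless_form m q \<longleftrightarrow> binary_pos_def q \<and> (\<forall>x. harmless m (binary_form q x x))"

text \<open>A summand above \<open>m\<close> settles the claim, since both are nonnegative.
  Otherwise \<open>m - 1\<close> occurs only with \<open>m >= 6\<close>. Then
  \<open>2 * (m - 1) > m\<close>, and adding a multiple of 4 to \<open>m - 1\<close> either changes
  nothing or leads beyond \<open>m\<close>.\<close>

lemma harmless_add:
  assumes m: "m > 0" "[m = 2] (mod 4)" and v: "harmless m v" and w: "harmless m w"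
  shows "harmless m (v + w)"
proof -
  have m_cases: "m = 2 \<or> m \<ge> 6"
    using m unfolding cong_def by presburger
  have nonneg: "v \<ge> 0" "w \<ge> 0"
    using v w by (simp_all add: harmless_def)
  have aux: "x = 0 \<or> x \<ge> 4" if "4 dvd x" "x \<ge> 0" for x :: int
    using that by presburger
  consider "v > m \<or> w > m" | "v = m - 1" "w = m - 1" "m \<noteq> 2" | "v = m - 1" "4 dvd w" "m \<noteq> 2"
    | "4 dvd v" "w = m - 1" "m \<noteq> 2" | "4 dvd v" "4 dvd w"
    using v w unfolding harmless_def by blast
  then show ?thesis
  proof cases
    case 3
    then show ?thesis
      using aux[of w] m_cases nonneg by (auto simp: harmless_def)
  next
    case 4
    then show ?thesis
      using aux[of v] m_cases nonneg by (auto simp: harmless_def)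
  qed (use m_cases nonneg in \<open>auto simp: harmless_def\<close>)
qed

lemma harmless_block_form:
  assumes m: "m > 0" "[m = 2] (mod 4)" and qs: "\<forall>q\<in>set qs. harmless_form m q"
  shows "harmless m (block_form qs x x)"
proof -
  have "harmless m (\<Sum>j\<in>J. binary_form (qs ! j) (block j x) (block j x))"
    if "finite J" "J \<subseteq> {..<length qs}" for J
    using that
  proof (induction rule: finite_induct)
    case (insert j J)
    then have "harmless_form m (qs ! j)"
      using qs by simp
    then have "harmless m (binary_form (qs ! j) (block j x) (block j x))"
      unfolding harmless_form_def by blast
    then show ?case
      using insert harmless_add[OF m] by simp
  qed (simp add: harmless_def)
  then show ?thesis
    by (simp add: block_form_def)
qed

lemma int_square_cases:
  fixes x :: int
  shows "x = 0 \<or> x = 1 \<or> x = -1 \<or> x * x \<ge> 4"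
proof (cases "\<bar>x\<bar> \<ge> 2")
  case True
  then have "2 * 2 \<le> \<bar>x\<bar> * \<bar>x\<bar>"
    by (intro mult_mono) auto
  then show ?thesis
    by (simp flip: abs_mult)
qed auto

lemma int_square_pos: "(x::int) * x \<ge> 1" if "x \<noteq> 0"
  using int_square_cases[of x] that by auto

text \<open>Let \<open>v\<close> and \<open>w\<close> be the images of the basis vectors of norms 1
  and \<open>m\<close>. The norm of \<open>v\<close> leaves no room for a nonzero block part, so
  \<open>v\<close> lies in \<open><1, m - 1>\<close>, and orthogonality to \<open>w\<close> concerns
  only these two coordinates. For \<open>m = 2\<close> this is a question about two vectors in
  \<open><1, 1>\<close>. For \<open>m >= 6\<close>, \<open>v\<close> is a unit vector in coordinate
  0, and \<open>m\<close> would have to be harmless.\<close>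

lemma not_represents_block_lattice:
  assumes m: "m > 0" "[m = 2] (mod 4)" and qs: "\<forall>q\<in>set qs. harmless_form m q"
  shows "\<not> represents (block_lattice (m - 1) qs) (diag_lattice [1, m])"
proof
  assume "represents (block_lattice (m - 1) qs) (diag_lattice [1, m])"
  then obtain \<sigma> where \<sigma>: "\<And>x y. \<lbrakk>x \<in> carrier (diag_lattice [1, m]);
      y \<in> carrier (diag_lattice [1, m])\<rbrakk> \<Longrightarrow>
      form (block_lattice (m - 1) qs) (\<sigma> x) (\<sigma> y) = form (diag_lattice [1, m]) x y"
    unfolding represents_def by blast
  define v w where "v = \<sigma> (frag_of 0)" and "w = \<sigma> (frag_of 1)"
  have carr: "frag_of 0 \<in> carrier (diag_lattice [1, m])" "frag_of 1 \<in> carrier (diag_lattice [1, m])"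
    by auto
  have l: "form (diag_lattice [1, m]) (frag_of 0) (frag_of 0) = 1"
      "form (diag_lattice [1, m]) (frag_of 1) (frag_of 1) = m"
      "form (diag_lattice [1, m]) (frag_of 0) (frag_of 1) = 0"
    by (subst form_diag_lattice_frag_of; simp)+
  define v0 v1 w0 w1 where "v0 = Poly_Mapping.lookup v 0" and "v1 = Poly_Mapping.lookup v 1"
    and "w0 = Poly_Mapping.lookup w 0" and "w1 = Poly_Mapping.lookup w 1"
  define V W where "V = block_form qs v v" and "W = block_form qs w w"
  have vv: "v0 * v0 + (m - 1) * v1 * v1 + V = 1"
    using \<sigma>[OF carr(1) carr(1)]
    unfolding l block_lattice_simps(4) v_def v0_def v1_def V_def .
  have ww: "w0 * w0 + (m - 1) * w1 * w1 + W = m"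
    using \<sigma>[OF carr(2) carr(2)]
    unfolding l block_lattice_simps(4) w_def w0_def w1_def W_def .
  have vw: "v0 * w0 + (m - 1) * v1 * w1 + block_form qs v w = 0"
    using \<sigma>[OF carr(1) carr(2)]
    unfolding l block_lattice_simps(4) v_def w_def v0_def v1_def w0_def w1_def .
  have V: "harmless m V" and W: "harmless m W"
    using harmless_block_form[OF m qs] by (simp_all add: V_def W_def)
  have m2: "m \<ge> 2"
    using m unfolding cong_def by presburger
  have "(m - 1) * (v1 * v1) \<ge> 0" "v0 * v0 \<ge> 0"
    using m2 by simp_all
  then have "V \<le> 1"
    using vv[unfolded mult.assoc] by linarith
  moreover have "m = 2 \<or> m \<ge> 6"
    using m unfolding cong_def by presburger
  ultimately have "4 dvd V" "0 \<le> V"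
    using V by (auto simp: harmless_def)
  with \<open>V \<le> 1\<close> have "V = 0"
    by presburger
  have "block_form qs v w = 0"
  proof -
    have "\<forall>q\<in>set qs. binary_pos_def q"
      using qs by (simp add: harmless_form_def)
    then have "block j v = (0, 0)" if "j < length qs" for j
      using block_form_eq_0D that \<open>V = 0\<close> unfolding V_def by blast
    then show ?thesis
      by (simp add: block_form_def)
  qed
  with vw have vw: "v0 * w0 + (m - 1) * v1 * w1 = 0"
    by simp
  show False
  proof (cases "m = 2")
    case True
    then have ww: "w0 * w0 + w1 * w1 + W = 2" and vv: "v0 * v0 + v1 * v1 = 1"
      and vw: "v0 * w0 + v1 * w1 = 0"
      using vv ww vw \<open>V = 0\<close> by simp_all
    have "W \<le> 2"
      using ww zero_le_square[of w0] zero_le_square[of w1] by linarith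
    then have "4 dvd W" "0 \<le> W"
      using W True by (auto simp: harmless_def)
    with \<open>W \<le> 2\<close> have "W = 0"
      by presburger
    \<comment> \<open>In \<open><1, 1>\<close> a vector of norm 2 has both coordinates equal to 1 or
      -1, so it is not orthogonal to a vector of norm 1.\<close>
    then have "w0 \<noteq> 0" "w1 \<noteq> 0"
      using ww int_square_cases[of w0] int_square_cases[of w1] by auto
    moreover have "v0 = 0 \<or> v1 = 0"
      using vv int_square_pos[of v0] int_square_pos[of v1] by linarith
    ultimately show False
      using vv vw by auto
  next
    case False
    then have m6: "m \<ge> 6"
      using m unfolding cong_def by presburger
    have "v1 * v1 = 0"
    proof (rule ccontr)
      assume "v1 * v1 \<noteq> 0"
      then have "v1 * v1 \<ge> 1"
        using zero_le_square[of v1] by linarith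
      then have "(m - 1) * (v1 * v1) \<ge> (m - 1) * 1"
        using m6 by (intro mult_left_mono) auto
      then have "m - 1 \<le> (m - 1) * (v1 * v1)"
        by (simp only: mult_1_right)
      then show False
        using vv[unfolded mult.assoc] \<open>V = 0\<close> m6 zero_le_square[of v0] by linarith
    qed
    then have "v1 = 0" "v0 \<noteq> 0"
      using vv \<open>V = 0\<close> by auto
    then have "w0 = 0"
      using vw by simp
    then have eq: "(m - 1) * (w1 * w1) + W = m"
      using ww by (simp add: mult.assoc)
    \<comment> \<open>For \<open>m >= 6\<close> the summand \<open><m - 1>\<close> itself has only
      harmless norms: 0, \<open>m - 1\<close>, or at least \<open>4 * (m - 1)\<close>.\<close>
    have "harmless m ((m - 1) * (w1 * w1))"
    proof -
      consider "w1 * w1 = 0" | "w1 * w1 = 1" | "w1 * w1 \<ge> 4"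
        using int_square_cases[of w1] by auto
      then show ?thesis
      proof cases
        case 3
        then have "(m - 1) * (w1 * w1) \<ge> (m - 1) * 4"
          using m6 by (intro mult_left_mono) auto
        then show ?thesis
          using m6 by (simp add: harmless_def)
      qed (use m6 in \<open>simp_all add: harmless_def\<close>)
    qed
    then have "harmless m m"
      using harmless_add[OF m _ W] eq by metis
    then show False
      using m unfolding harmless_def cong_def by presburger
  qed
qed

section \<open>Proper subgroups of a binary lattice\<close>

text \<open>Division with remainder by the least positive element \<open>d\<close> shows that
  \<open>d\<close> divides every element; the two outcomes are \<open>d = 1\<close> and
  \<open>d >= 2\<close>.\<close>

lemma int_subgroup_cases:
  fixes A :: "int set"
  assumes "0 \<in> A" and diff: "\<And>x y. \<lbrakk>x \<in> A; y \<in> A\<rbrakk> \<Longrightarrow> x - y \<in> A"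
  obtains "1 \<in> A" | n where "n \<ge> 2" "\<And>x. x \<in> A \<Longrightarrow> n dvd x"
proof (cases "A \<subseteq> {0}")
  case True
  then show ?thesis
    using that(2)[of 2] by auto
next
  case False
  have neg: "- x \<in> A" if "x \<in> A" for x
    using diff[OF \<open>0 \<in> A\<close> that] by simp
  have add: "x + y \<in> A" if "x \<in> A" "y \<in> A" for x y
    using diff[OF that(1) neg[OF that(2)]] by simp
  have mult: "x * int k \<in> A" if "x \<in> A" for x k
    by (induction k) (auto simp: \<open>0 \<in> A\<close> algebra_simps intro: add that)
  have mult_int: "x * k \<in> A" if "x \<in> A" for x k
    using mult[OF that, of "nat \<bar>k\<bar>"] neg[of "x * \<bar>k\<bar>"] by (cases "k \<ge> 0") auto
  obtain x where "x \<in> A" "x \<noteq> 0"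
    using False by auto
  then have ex: "\<exists>k. k > 0 \<and> int k \<in> A"
    using neg[of x] by (intro exI[of _ "nat \<bar>x\<bar>"]) (auto simp: abs_if)
  define d where "d = (LEAST k. k > 0 \<and> int k \<in> A)"
  have d: "d > 0" "int d \<in> A"
    using LeastI_ex[OF ex] by (auto simp: d_def)
  have dvd: "int d dvd x" if "x \<in> A" for x
  proof (rule ccontr)
    assume "\<not> int d dvd x"
    then have "x mod int d \<noteq> 0" "x mod int d \<ge> 0" "x mod int d < int d"
      using d by (auto simp: dvd_eq_mod_eq_0)
    moreover have "x mod int d \<in> A"
      using diff[OF that mult_int[OF d(2), of "x div int d"]] by (simp add: minus_mult_div_eq_mod)
    ultimately show False
      using not_less_Least[of "nat (x mod int d)" "\<lambda>k. k > 0 \<and> int k \<in> A"]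
      unfolding d_def[symmetric] by (simp add: nat_less_iff)
  qed
  show ?thesis
  proof (cases "d = 1")
    case True
    then show ?thesis
      using d that(1) by simp
  next
    case False
    then show ?thesis
      using d dvd that(2)[of "int d"] by auto
  qed
qed

lemma diag_lattice_binary_eqI:
  assumes "x \<in> carrier (diag_lattice [a, b])" "y \<in> carrier (diag_lattice [a, b])"
    "Poly_Mapping.lookup x 0 = Poly_Mapping.lookup y 0"
    "Poly_Mapping.lookup x 1 = Poly_Mapping.lookup y 1"
  shows "x = y"
proof (rule poly_mapping_eqI)
  fix i
  show "Poly_Mapping.lookup x i = Poly_Mapping.lookup y i"
  proof (cases "i < 2")
    case True
    then have "i = 0 \<or> i = 1"
      by auto
    then show ?thesis
      using assms by auto
  next
    case False
    then have "i \<notin> Poly_Mapping.keys x" "i \<notin> Poly_Mapping.keys y"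
      using assms(1,2) by (auto simp: numeral_2_eq_2)
    then show ?thesis
      by (simp add: in_keys_iff)
  qed
qed

text \<open>If the second coordinates of \<open>H\<close> do not fill the integers, they have a
  common divisor \<open>n >= 2\<close>. Otherwise some \<open>e\<close> in \<open>H\<close> has
  second coordinate 1. Subtracting multiples of \<open>e\<close> reduces to the vectors of
  \<open>H\<close> with second coordinate 0, whose first coordinates again form a subgroup of the
  integers. It cannot contain 1, since \<open>H\<close> would then be everything.\<close>

lemma proper_subgroup_binary_cases:
  assumes H: "subgroup H (diag_lattice [a, b])" "H \<noteq> carrier (diag_lattice [a, b])"
    and ab: "a > 0" "b > 0"
  obtains (right) n where "n \<ge> 2" "\<And>x. x \<in> H \<Longrightarrow> n dvd Poly_Mapping.lookup x 1"
  | (left) n r where "n \<ge> 2" "0 \<le> r" "r < n"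
      "\<And>x. x \<in> H \<Longrightarrow> n dvd Poly_Mapping.lookup x 0 - r * Poly_Mapping.lookup x 1"
proof -
  let ?G = "diag_lattice [a, b]"
  interpret zlattice ?G
    using zlattice_diag_lattice[of "[a, b]"] ab by auto
  interpret H: subgroup H ?G
    by fact
  have inv_eq: "inv\<^bsub>?G\<^esub> x = - x" if "x \<in> H" for x
    using inv_equality[of "- x" x] that H.subset by auto
  have zero: "0 \<in> H"
    using H.one_closed by simp
  have diff: "x - y \<in> H" if "x \<in> H" "y \<in> H" for x y
    using H.m_closed[OF that(1) H.m_inv_closed[OF that(2)]] inv_eq[OF that(2)] by simp
  have add: "x + y \<in> H" if "x \<in> H" "y \<in> H" for x y
    using H.m_closed[OF that] by simp
  have mult: "frag_cmul k x \<in> H" if "x \<in> H" for x k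
  proof (induction k rule: int_induct[of _ 0])
    case (step1 i)
    then show ?case
      using add[OF _ that] by (simp add: frag_cmul_distrib)
  next
    case (step2 i)
    then show ?case
      using diff[OF _ that] by (simp add: frag_cmul_diff_distrib)
  qed (simp add: zero)
  have 0: "0 \<in> (\<lambda>x. Poly_Mapping.lookup x 1) ` H"
    using zero by (force simp: image_iff)
  have 1: "a - b \<in> (\<lambda>x. Poly_Mapping.lookup x 1) ` H"
    if "a \<in> (\<lambda>x. Poly_Mapping.lookup x 1) ` H" "b \<in> (\<lambda>x. Poly_Mapping.lookup x 1) ` H" for a b
    using that diff by (auto simp: image_iff) (metis lookup_minus)
  have 2: "0 \<in> (\<lambda>x. Poly_Mapping.lookup x 0) ` {x \<in> H. Poly_Mapping.lookup x 1 = 0}"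
    using zero by (force simp: image_iff)
  have 3: "a - b \<in> (\<lambda>x. Poly_Mapping.lookup x 0) ` {x \<in> H. Poly_Mapping.lookup x 1 = 0}"
    if "a \<in> (\<lambda>x. Poly_Mapping.lookup x 0) ` {x \<in> H. Poly_Mapping.lookup x 1 = 0}"
      "b \<in> (\<lambda>x. Poly_Mapping.lookup x 0) ` {x \<in> H. Poly_Mapping.lookup x 1 = 0}" for a b
  proof -
    obtain x y where "x \<in> H" "y \<in> H" "Poly_Mapping.lookup x 1 = 0"
        "Poly_Mapping.lookup y 1 = 0" "a = Poly_Mapping.lookup x 0" "b = Poly_Mapping.lookup y 0"
      using \<open>a \<in> _\<close> \<open>b \<in> _\<close> by auto
    then show ?thesis
      using diff[of x y] by (intro image_eqI[of _ _ "x - y"]) (simp_all add: lookup_minus)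
  qed
  show ?thesis
  proof (rule int_subgroup_cases[OF 0 1])
    fix n :: int assume "n \<ge> 2" "\<And>x. x \<in> (\<lambda>x. Poly_Mapping.lookup x 1) ` H \<Longrightarrow> n dvd x"
    then show ?thesis
      using right[of n] by blast
  next
    assume "1 \<in> (\<lambda>x. Poly_Mapping.lookup x 1) ` H"
    then obtain e where e: "e \<in> H" "Poly_Mapping.lookup e 1 = 1"
      by auto
    show ?thesis
    proof (rule int_subgroup_cases[OF 2 3])
      assume "1 \<in> (\<lambda>x. Poly_Mapping.lookup x 0) ` {x \<in> H. Poly_Mapping.lookup x 1 = 0}"
      then obtain d where d: "d \<in> H" "Poly_Mapping.lookup d 1 = 0" "Poly_Mapping.lookup d 0 = 1"
        by auto
      have "x \<in> H" if x: "x \<in> carrier ?G" for x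
      proof -
        \<comment> \<open>Here \<open>e\<close> and \<open>d\<close> form a basis of the whole
          lattice, and \<open>y\<close> is the expansion of \<open>x\<close> in it.\<close>
        define y where "y = frag_cmul (Poly_Mapping.lookup x 1) e + frag_cmul
          (Poly_Mapping.lookup x 0 - Poly_Mapping.lookup x 1 * Poly_Mapping.lookup e 0) d"
        have y: "y \<in> H"
          unfolding y_def using add mult e d by blast
        have "x = y"
        proof (rule diag_lattice_binary_eqI[OF x])
          show "y \<in> carrier ?G"
            using y H.subset by blast
        qed (use e d in \<open>simp_all add: y_def lookup_add\<close>)
        then show ?thesis
          using y by simp
      qed
      then show ?thesis
        using H(2) H.subset by blast
    next
      fix n :: int
      assume n: "n \<ge> 2"
        "\<And>a. a \<in> (\<lambda>x. Poly_Mapping.lookup x 0) ` {x \<in> H. Poly_Mapping.lookup x 1 = 0} \<Longrightarrow> n dvd a"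
      define r where "r = Poly_Mapping.lookup e 0 mod n"
      have "n dvd Poly_Mapping.lookup x 0 - r * Poly_Mapping.lookup x 1" if x: "x \<in> H" for x
      proof -
        define y where "y = x - frag_cmul (Poly_Mapping.lookup x 1) e"
        have "y \<in> H" "Poly_Mapping.lookup y 1 = 0"
          using diff[OF x mult[OF e(1)]] e(2) by (simp_all add: y_def lookup_minus)
        then have "n dvd Poly_Mapping.lookup y 0"
          using n(2) by blast
        then have "n dvd Poly_Mapping.lookup x 0 - Poly_Mapping.lookup e 0 * Poly_Mapping.lookup x 1"
          by (simp add: y_def lookup_minus mult.commute)
        moreover have "n dvd (Poly_Mapping.lookup e 0 - r) * Poly_Mapping.lookup x 1"
          by (simp add: r_def minus_mod_eq_mult_div)
        ultimately have "n dvd (Poly_Mapping.lookup x 0 - Poly_Mapping.lookup e 0 * Poly_Mapping.lookup x 1)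
            + (Poly_Mapping.lookup e 0 - r) * Poly_Mapping.lookup x 1"
          by (rule dvd_add)
        then show ?thesis
          by (simp add: left_diff_distrib)
      qed
      then show ?thesis
        using left[of n r] n(1) by (auto simp: r_def)
    qed
  qed
qed

section \<open>The blocks for the different kinds of sublattices\<close>

lemma harmless_formI:
  assumes "\<And>s t. (s, t) \<noteq> (0, 0) \<Longrightarrow> 0 < binary_form q (s, t) (s, t) \<and>
      harmless m (binary_form q (s, t) (s, t))"
  shows "harmless_form m q"
  unfolding harmless_form_def binary_pos_def_def
proof (intro conjI allI impI)
  fix x
  show "harmless m (binary_form q x x)"
    by (cases x; cases "x = (0, 0)") (use assms in \<open>auto simp: harmless_def\<close>)
  show "0 < binary_form q x x" if "x \<noteq> (0, 0)"
    using assms that by (cases x) auto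
qed

lemma harmless_form_diag:
  assumes "m > 0" "a > m" "b > m"
  shows "harmless_form m (a, 0, b)"
proof (rule harmless_formI)
  fix s t :: int assume st: "(s, t) \<noteq> (0, 0)"
  have "a * (s * s) + b * (t * t) > m"
  proof (cases "s = 0")
    case True
    then have "b * 1 \<le> b * (t * t)"
      using st int_square_pos[of t] assms by (intro mult_left_mono) auto
    then have "m < b * (t * t)"
      using assms by linarith
    then show ?thesis
      using True by simp
  next
    case False
    then have "a * 1 \<le> a * (s * s)"
      using int_square_pos[of s] assms by (intro mult_left_mono) auto
    moreover have "b * (t * t) \<ge> 0"
      using assms by simp
    ultimately show ?thesis
      using assms by linarith
  qed
  then show "0 < binary_form (a, 0, b) (s, t) (s, t) \<and>
      harmless m (binary_form (a, 0, b) (s, t) (s, t))"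
    using assms by (simp add: harmless_def mult.assoc)
qed

text \<open>The form is \<open>u^2 + m * t^2\<close> with \<open>u = n * s + r * t\<close>, so
  nothing is split off. All nonzero norms exceed \<open>m\<close>: for \<open>t = 0\<close> because
  \<open>n * n > m\<close>, for \<open>t = 1\<close> or \<open>t = -1\<close> because
  \<open>n\<close> does not divide \<open>r\<close> and hence \<open>u\<close> is nonzero, and
  otherwise because \<open>4 * m > m\<close>.\<close>

lemma harmless_form_large_index:
  assumes m: "m > 0" and n: "n * n > m" and r: "0 < r" "r < n"
  shows "harmless_form m (n * n, n * r, r * r + m)"
proof (rule harmless_formI)
  fix s t :: int assume st: "(s, t) \<noteq> (0, 0)"
  have eq: "binary_form (n * n, n * r, r * r + m) (s, t) (s, t) =
      (n * s + r * t) * (n * s + r * t) + m * (t * t)"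
    by (simp add: algebra_simps)
  have "\<dots> > m"
  proof -
    consider "t = 0" | "t = 1 \<or> t = -1" | "t * t \<ge> 4"
      using int_square_cases[of t] by auto
    then show ?thesis
    proof cases
      case 1
      then have "n * n * 1 \<le> n * n * (s * s)"
        using st int_square_pos[of s] by (intro mult_left_mono) auto
      then show ?thesis
        using 1 n by (simp add: mult_ac)
    next
      case 2
      have "\<not> n dvd r * t"
        using 2 r zdvd_not_zless by auto
      then have "n * s + r * t \<noteq> 0"
        by (metis add.commute add_eq_0_iff dvd_minus_iff dvd_triv_left)
      then show ?thesis
        using int_square_pos[of "n * s + r * t"] 2 by auto
    next
      case 3
      then have "m * 4 \<le> m * (t * t)"
        using m by (intro mult_left_mono) auto
      then show ?thesis
        using m zero_le_square[of "n * s + r * t"] by linarith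
    qed
  qed
  then show "0 < binary_form (n * n, n * r, r * r + m) (s, t) (s, t) \<and>
      harmless m (binary_form (n * n, n * r, r * r + m) (s, t) (s, t))"
    unfolding eq using m by (auto simp: harmless_def)
qed

text \<open>For \<open>r = 0\<close> the sublattice may contain a vector of norm \<open>m\<close>,
  which is not harmless. Splitting off the square of the second coordinate lowers this norm to
  \<open>m - 1\<close>. The parameter \<open>n\<close> is later instantiated by a square
  \<open>n * n\<close>.\<close>

lemma harmless_form_large_index_0:
  assumes m: "m \<ge> 6" and n: "n > m"
  shows "harmless_form m (n, 0, m - 1)"
proof (rule harmless_formI)
  fix s t :: int assume st: "(s, t) \<noteq> (0, 0)"
  have "n * (s * s) + (m - 1) * (t * t) > m \<or> n * (s * s) + (m - 1) * (t * t) = m - 1"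
  proof (cases "s = 0")
    case True
    consider "t = 1 \<or> t = -1" | "t * t \<ge> 4"
      using int_square_cases[of t] st True by auto
    then show ?thesis
    proof cases
      case 2
      then have "(m - 1) * 4 \<le> (m - 1) * (t * t)"
        using m by (intro mult_left_mono) auto
      then show ?thesis
        using True m by simp
    qed (use True in auto)
  next
    case False
    then have "n * 1 \<le> n * (s * s)"
      using int_square_pos[of s] assms by (intro mult_left_mono) auto
    moreover have "(m - 1) * (t * t) \<ge> 0"
      using assms by simp
    ultimately show ?thesis
      using assms by linarith
  qed
  then show "0 < binary_form (n, 0, m - 1) (s, t) (s, t) \<and>
      harmless m (binary_form (n, 0, m - 1) (s, t) (s, t))"
    using assms by (auto simp: harmless_def mult.assoc)
qed

lemma harmless_form_small_index:
  assumes m: "m > 0" and n: "2 \<le> n" "n \<le> m" and r: "0 \<le> r" "r < n" and m2: "m = 2 \<Longrightarrow> r \<noteq> 0"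
  shows "harmless_form m
    (n * n - (n - 2) * (n - 2), n * r - (n - 2) * (r - 1), r * r + m - (r - 1) * (r - 1))"
    (is "harmless_form m ?q")
proof (rule harmless_formI)
  fix s t :: int assume st: "(s, t) \<noteq> (0, 0)"
  \<comment> \<open>With \<open>u = n * s + r * t\<close> and
    \<open>f = (n - 2) * s + (r - 1) * t\<close>, this is \<open>u^2 - f^2\<close>, factored as
    \<open>(u - f) * (u + f)\<close>.\<close>
  define P where "P = (2 * s + t) * ((2 * n - 2) * s + (2 * r - 1) * t)"
  have eq: "binary_form ?q (s, t) (s, t) = P + m * (t * t)"
    by (simp add: P_def algebra_simps)
  have one: "P > 0 \<or> (r = 0 \<and> P = -1)" if t: "t = 1 \<or> t = -1"
  proof -
    \<comment> \<open>Since \<open>t * t = 1\<close>, both factors of \<open>P\<close> may be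
      multiplied by \<open>t\<close>. They then have the same sign for \<open>u\<close> nonzero, and
      \<open>u = 0\<close> gives \<open>2 * r - 1\<close>, which is negative only for
      \<open>r = 0\<close>.\<close>
    define u where "u = s * t"
    have "P = (2 * u + 1) * ((2 * n - 2) * u + (2 * r - 1))"
      using t by (auto simp: P_def u_def algebra_simps)
    moreover have "(2 * u + 1) * ((2 * n - 2) * u + (2 * r - 1)) > 0" if "u < 0"
    proof (rule mult_neg_neg)
      have "(2 * n - 2) * u \<le> (2 * n - 2) * (-1)"
        using that n by (intro mult_left_mono) auto
      also have "\<dots> = 2 - 2 * n"
        by simp
      finally show "(2 * n - 2) * u + (2 * r - 1) < 0"
        using r by linarith
    qed (use that in simp)
    moreover have "(2 * u + 1) * ((2 * n - 2) * u + (2 * r - 1)) > 0" if "u > 0"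
    proof (rule mult_pos_pos)
      have "(2 * n - 2) * 1 \<le> (2 * n - 2) * u"
        using that n by (intro mult_left_mono) auto
      then have "2 * n - 2 \<le> (2 * n - 2) * u"
        by (simp only: mult_1_right)
      then show "(2 * n - 2) * u + (2 * r - 1) > 0"
        using r n by linarith
    qed (use that in simp)
    ultimately show ?thesis
      using r by (cases u "0 :: int" rule: linorder_cases) auto
  qed
  show "0 < binary_form ?q (s, t) (s, t) \<and> harmless m (binary_form ?q (s, t) (s, t))"
    unfolding eq
  proof -
    consider "t = 0" | "t = 1 \<or> t = -1" | "t * t \<ge> 4"
      using int_square_cases[of t] by auto
    then show "0 < P + m * (t * t) \<and> harmless m (P + m * (t * t))"
    proof cases
      case 1
      then have P: "P = 4 * ((n - 1) * (s * s))" "s * s \<ge> 1"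
        using int_square_pos[of s] st by (auto simp: P_def algebra_simps)
      then have "(n - 1) * (s * s) > 0"
        using n by (intro mult_pos_pos[of "n - 1" "s * s"]) linarith+
      then show ?thesis
        using 1 P by (simp add: harmless_def)
    next
      case 2
      then have "P + m * (t * t) > m \<or> (r = 0 \<and> P + m * (t * t) = m - 1)"
        using one by auto
      then show ?thesis
        using m n m2 by (auto simp: harmless_def)
    next
      case 3
      \<comment> \<open>Completing the square in \<open>s\<close> bounds \<open>P\<close> from below
        by a multiple of \<open>t * t\<close>. The bound \<open>n <= m\<close> makes
        \<open>m * (t * t) - m\<close>, which is at least three quarters of
        \<open>m * (t * t)\<close>, outweigh it.\<close>
      define X where "X = 4 * (n - 1) * s + (n + 2 * r - 2) * t"
      have "4 * (n - 1) * P = X * X - (n - 2 * r) * (n - 2 * r) * (t * t)"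
        by (simp add: P_def X_def algebra_simps)
      moreover have "(n - 2 * r) * (n - 2 * r) * (t * t) \<le> n * n * (t * t)"
      proof (rule mult_right_mono)
        have "\<bar>n - 2 * r\<bar> * \<bar>n - 2 * r\<bar> \<le> n * n"
          using r by (intro mult_mono) auto
        then show "(n - 2 * r) * (n - 2 * r) \<le> n * n"
          by (simp flip: abs_mult)
      qed simp
      ultimately have "4 * (n - 1) * P \<ge> - (n * n * (t * t))"
        using zero_le_square[of X] by linarith
      moreover have "(n - 1) * m * (3 * (t * t)) \<le> (n - 1) * m * (4 * (t * t) - 4)"
        using 3 m n by (intro mult_left_mono) auto
      moreover have "n * n * (t * t) < (n - 1) * m * (3 * (t * t))"
      proof -
        have "(n - 1) * n \<le> (n - 1) * m"
          using n by (intro mult_left_mono) auto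
        moreover have "2 * n \<le> n * n"
          using n by (intro mult_right_mono) auto
        moreover have "(n - 1) * n = n * n - n"
          by (simp add: algebra_simps)
        ultimately have "n * n < (n - 1) * m * 3"
          using n(1) by linarith
        then have "n * n * (t * t) < (n - 1) * m * 3 * (t * t)"
          using 3 by (intro mult_strict_right_mono) auto
        then show ?thesis
          by (simp add: mult.assoc)
      qed
      ultimately have "4 * (n - 1) * (P + m * (t * t) - m) > 0"
        by (simp add: algebra_simps)
      then have "P + m * (t * t) > m"
        using n by (simp add: zero_less_mult_iff)
      then show ?thesis
        using m by (simp add: harmless_def)
    qed
  qed
qed

section \<open>Embedding every proper sublattice, and the theorem\<close>

text \<open>The form \<open>q\<close> depends on \<open>H\<close> alone and is chosen before
  \<open>qs\<close>, so that the forms of all sublattices can be collected into one list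
  afterwards.\<close>

lemma proper_subgroup_embedding:
  assumes m: "m > 0" "[m = 2] (mod 4)"
    and H: "subgroup H (diag_lattice [1, m])" "H \<noteq> carrier (diag_lattice [1, m])"
  shows "\<exists>q. harmless_form m q \<and> (\<forall>qs. q \<in> set qs \<longrightarrow>
    represents (block_lattice (m - 1) qs) ((diag_lattice [1, m])\<lparr>carrier := H\<rparr>))"
proof -
  let ?l = "(diag_lattice [1, m])\<lparr>carrier := H\<rparr>"
  let ?u = "\<lambda>x. Poly_Mapping.lookup x (0::nat) :: int"
  let ?v = "\<lambda>x. Poly_Mapping.lookup x (1::nat) :: int"
  have hom: "f \<in> hom ?l integer_group" if "\<And>x y. \<lbrakk>x \<in> H; y \<in> H\<rbrakk> \<Longrightarrow> f (x + y) = f x + f y" for f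
    using that by (auto simp: hom_def)
  have form_l: "form ?l x y = ?u x * ?u y + m * ?v x * ?v y" for x y
    by (simp add: diag_lattice_def zlattice.defs monoid.defs)
  have m_cases: "m = 2 \<or> m \<ge> 6"
    using m unfolding cong_def by presburger
  have conclude: ?thesis
    if "harmless_form m q"
      and "\<And>x y. \<lbrakk>x \<in> H; y \<in> H\<rbrakk> \<Longrightarrow> f (x + y) = f x + f y \<and> g (x + y) = g x + g y \<and>
        s (x + y) = s x + s y \<and> t (x + y) = t x + t y"
      and form_eq: "\<And>x y. \<lbrakk>x \<in> H; y \<in> H\<rbrakk> \<Longrightarrow> ?u x * ?u y + m * ?v x * ?v y =
        f x * f y + (m - 1) * g x * g y + binary_form q (s x, t x) (s y, t y)"
    for q f g s t
  proof (intro exI[of _ q] conjI allI impI)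
    fix qs assume "q \<in> set qs"
    show "represents (block_lattice (m - 1) qs) ?l"
    proof (rule represents_block_lattice[OF _ _ _ _ \<open>q \<in> set qs\<close>])
      show "f \<in> hom ?l integer_group" "g \<in> hom ?l integer_group"
        "s \<in> hom ?l integer_group" "t \<in> hom ?l integer_group"
        using that(2) by (auto intro!: hom)
      show "form ?l x y = f x * f y + (m - 1) * g x * g y + binary_form q (s x, t x) (s y, t y)"
        if "x \<in> carrier ?l" "y \<in> carrier ?l" for x y
        unfolding form_l using form_eq that by simp
    qed
  qed (rule that(1))
  from H zero_less_one m(1) show ?thesis
  proof (cases rule: proper_subgroup_binary_cases)
    case (right n)
    define w where "w x = ?v x div n" for x
    have v: "?v x = n * w x" if "x \<in> H" for x
      using right(2)[OF that] by (simp add: w_def)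
    have w_add: "w (x + y) = w x + w y" if "x \<in> H" "y \<in> H" for x y
      using right(2)[OF that(1)] right(2)[OF that(2)] by (simp add: w_def lookup_add)
    have "2 * 2 \<le> n * n"
      using right(1) by (intro mult_mono) auto
    then have "1 * m < n * n * m"
      using m(1) by (intro mult_strict_right_mono) auto
    \<comment> \<open>The first coordinate goes to \<open><1>\<close>, and
      \<open>m * v^2 = n * n * m * w^2\<close> goes to the block. Repeating the entry gives the
      block rank two; the embedding puts 0 there.\<close>
    then have "harmless_form m (n * n * m, 0, n * n * m)"
      using m(1) by (intro harmless_form_diag) auto
    then show ?thesis
      by (rule conclude[of _ ?u "\<lambda>_. 0" w "\<lambda>_. 0"])
        (simp_all add: lookup_add w_add v algebra_simps del: One_nat_def)
  next
    case (left n r)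
    define w where "w x = (?u x - r * ?v x) div n" for x
    have u: "?u x = n * w x + r * ?v x" if "x \<in> H" for x
      using left(4)[OF that] by (simp add: w_def)
    have w_add: "w (x + y) = w x + w y" if "x \<in> H" "y \<in> H" for x y
    proof -
      have "?u (x + y) - r * ?v (x + y) = (?u x - r * ?v x) + (?u y - r * ?v y)"
        by (simp add: lookup_add algebra_simps)
      then show ?thesis
        using left(4)[OF that(1)] left(4)[OF that(2)] by (simp only: w_def div_add)
    qed
    have "2 * n \<le> n * n"
      using left(1) by (intro mult_right_mono) auto
    then have nn: "n * n > 2" "n > m \<Longrightarrow> n * n > m"
      using left(1) by linarith+
    consider "n \<le> m" "m = 2 \<Longrightarrow> r \<noteq> 0" | "n > m" "r = 0" "m \<ge> 6" | "r = 0" "m = 2" | "n > m" "r > 0"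
      using m_cases left(2) by linarith
    then show ?thesis
    proof cases
      case 1
      then have "harmless_form m (n * n - (n - 2) * (n - 2), n * r - (n - 2) * (r - 1),
          r * r + m - (r - 1) * (r - 1))"
        using left m by (intro harmless_form_small_index) auto
      then show ?thesis
        by (rule conclude[of _ "\<lambda>x. (n - 2) * w x + (r - 1) * ?v x" "\<lambda>_. 0" w ?v])
          (simp_all add: lookup_add w_add u algebra_simps)
    next
      case 2
      then have "harmless_form m (n * n, 0, m - 1)"
        using nn(2) by (intro harmless_form_large_index_0)
      then show ?thesis
        by (rule conclude[of _ ?v "\<lambda>_. 0" w ?v])
          (use 2 in \<open>simp_all add: lookup_add w_add u algebra_simps\<close>)
    next
      case 3
      \<comment> \<open>Here \<open>m * v^2\<close> is \<open>v^2 + v^2\<close> and is absorbed by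
        \<open><1> + <m - 1> = <1, 1>\<close>; only \<open>n * n * w^2\<close> is left for the
        block.\<close>
      then have "harmless_form m (n * n, 0, n * n)"
        using nn(1) by (intro harmless_form_diag) auto
      then show ?thesis
        by (rule conclude[of _ ?v ?v w "\<lambda>_. 0"])
          (use 3 in \<open>simp_all add: lookup_add w_add u algebra_simps\<close>)
    next
      case 4
      then have "harmless_form m (n * n, n * r, r * r + m)"
        using nn(2) left(3) m(1) by (intro harmless_form_large_index)
      then show ?thesis
        by (rule conclude[of _ "\<lambda>_. 0" "\<lambda>_. 0" w ?v])
          (simp_all add: lookup_add w_add u algebra_simps)
    qed
  qed
qed

theorem proposition4p3:
  fixes m :: int
  assumes "m > 0" and "[m = 2] (mod 4)"
  shows "\<not> recoverable (diag_lattice [1, m])"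
proof
  let ?l = "diag_lattice [1, m]"
  assume "recoverable ?l"
  then obtain \<H> where \<H>: "finite \<H>" "\<And>H. H \<in> \<H> \<Longrightarrow> subgroup H ?l \<and> H \<noteq> carrier ?l"
    and rec: "\<And>L :: (nat \<Rightarrow>\<^sub>0 int) zlattice. \<lbrakk>zlattice L; \<forall>H\<in>\<H>. represents L (?l\<lparr>carrier := H\<rparr>)\<rbrakk>
      \<Longrightarrow> represents L ?l"
    unfolding recoverable_def by blast
  have "\<forall>H\<in>\<H>. \<exists>q. harmless_form m q \<and> (\<forall>qs. q \<in> set qs \<longrightarrow>
      represents (block_lattice (m - 1) qs) (?l\<lparr>carrier := H\<rparr>))"
    using \<H>(2) proper_subgroup_embedding[OF assms] by blast
  from bchoice[OF this] obtain q where q: "\<forall>H\<in>\<H>. harmless_form m (q H) \<and> (\<forall>qs. q H \<in> set qs \<longrightarrow>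
      represents (block_lattice (m - 1) qs) (?l\<lparr>carrier := H\<rparr>))"
    ..
  have "finite (q ` \<H>)"
    using \<H>(1) by simp
  \<comment> \<open>Finiteness of the family allows all blocks to sit in a single lattice of finite
    rank.\<close>
  from finite_list[OF this] obtain qs where qs: "set qs = q ` \<H>"
    ..
  have harmless: "\<forall>q\<in>set qs. harmless_form m q"
    using q qs by auto
  have "m - 1 > 0"
    using assms unfolding cong_def by presburger
  then have "zlattice (block_lattice (m - 1) qs)"
    using harmless by (intro zlattice_block_lattice) (auto simp only: harmless_form_def)
  then have "represents (block_lattice (m - 1) qs) ?l"
    by (rule rec) (use q qs in blast)
  then show False
    using not_represents_block_lattice[OF assms harmless] by blast
qed

end
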